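(* Let $\mathcal{F}$ be a family of finite posets closed under taking lower and upper ideals, such that for every $P\in\mathcal{F}$ the linear coefficient $c_1(P):=[t^1]\,\Omega(P;t)$ of the order polynomial satisfies $c_1(P)\ge 0$. Then for every $P\in\mathcal{F}$ the polynomial $|P|!\cdot\Omega(P;t)$ has nonnegative integer coefficients.
   Context: For a finite poset $P$, the order polynomial $\Omega(P;t)$ is the unique polynomial in $\mathbb{Q}[t]$ such that for every positive integer $t$, $\Omega(P;t)$ equals the number of maps $f:P\to\{1,\dots,t\}$ with $f(x)\le f(y)$ whenever $x\preceq y$; for $P=\varnothing$ one sets $\Omega(P;t)=1$. A (lower) order ideal $I$ of $P$ is a down-closed subset; its complement $P\setminus I$ is an upper ideal; both carry the induced order. The family $\mathcal{F}$ is closed under taking lower and upper ideals if for every $P\in\mathcal{F}$ and every order ideal $I\subseteq P$ one has $I\in\mathcal{F}$ and $P\setminus I\in\mathcal{F}$. $[t^k]\,p(t)$ denotes the coefficient of $t^k$ in $p$. *)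

theory Defs
  imports Complex_Main "HOL-Library.FuncSet" "HOL-Computational_Algebra.Polynomial"
begin

text \<open>A poset is a pair of its ground set and its order relation on that set;
  \<^term>\<open>(x, y) \<in> r\<close> stands for $x \preceq y$.\<close>

type_synonym 'a poset = "'a set \<times> 'a rel"

definition finite_poset :: "'a poset \<Rightarrow> bool" where
  "finite_poset P \<longleftrightarrow> finite (fst P) \<and> partial_order_on (fst P) (snd P)"

definition order_ideal :: "'a poset \<Rightarrow> 'a set \<Rightarrow> bool" where
  "order_ideal P I \<longleftrightarrow> I \<subseteq> fst P \<and> (\<forall>x y. (x, y) \<in> snd P \<and> y \<in> I \<longrightarrow> x \<in> I)"

definition induced :: "'a poset \<Rightarrow> 'a set \<Rightarrow> 'a poset" where
  "induced P B = (B, Restr (snd P) B)"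

text \<open>Maps are taken in the extensional function space, so that each map on the ground
  set is counted once; on the empty poset there is exactly one.\<close>

definition order_maps :: "'a poset \<Rightarrow> nat \<Rightarrow> ('a \<Rightarrow> nat) set" where
  "order_maps P t = {f \<in> fst P \<rightarrow>\<^sub>E {1..t}. \<forall>x y. (x, y) \<in> snd P \<longrightarrow> f x \<le> f y}"

definition order_polynomial :: "'a poset \<Rightarrow> rat poly" where
  "order_polynomial P =
     (THE p. \<forall>t::nat. 0 < t \<longrightarrow> poly p (of_nat t) = of_nat (card (order_maps P t)))"

definition closed_under_ideals :: "'a poset set \<Rightarrow> bool" where
  "closed_under_ideals \<F> \<longleftrightarrow>
     (\<forall>P\<in>\<F>. \<forall>I. order_ideal P I \<longrightarrow> induced P I \<in> \<F> \<and> induced P (fst P - I) \<in> \<F>)"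

end

theory Submission
  imports Defs
begin

text \<open>
  Cutting an order-preserving map into \<open>{1..s+t}\<close> at height \<open>s\<close> splits it into an order-preserving
  map on an ideal \<open>I\<close> (the elements sent to at most \<open>s\<close>) and one on the complement, so
  \<open>\<Omega>(P; s+t) = (\<Sum>I. \<Omega>(I; s) * \<Omega>(P - I; t))\<close>
  (lemma \<open>card_order_maps_add\<close>). Both halves of the claim come out of this one identity.

  \<^bold>\<open>Integrality.\<close> For \<open>t = 1\<close> the identity says that the forward difference of \<open>\<Omega>(P; \<cdot>)\<close> is the sum of
  the \<open>\<Omega>(I; \<cdot>)\<close> over the proper ideals. Since \<open>t choose (k+1)\<close> has forward difference \<open>t choose k\<close>,
  induction on \<open>|P|\<close> writes \<open>\<Omega>(P; t)\<close> as a natural combination of the \<open>t choose k\<close> with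
  \<open>k \<le> |P|\<close> (lemma \<open>card_order_maps_binomial_expansion\<close>). This shows that \<open>\<Omega>(P; \<cdot>)\<close> is a polynomial,
  and multiplying by \<open>|P|!\<close> clears all the denominators \<open>k!\<close>.

  \<^bold>\<open>Nonnegativity.\<close> Comparing coefficients of \<open>s\<close> in the identity gives
  \<open>\<Omega>'(P; t) = (\<Sum>I. c\<^sub>1(I) * \<Omega>(P - I; t))\<close> (lemma \<open>pderiv_order_polynomial\<close>). The empty ideal
  contributes nothing because \<open>\<Omega>(\<emptyset>; t) = 1\<close>, so every positive-degree coefficient of \<open>\<Omega>(P; t)\<close> is a
  nonnegative combination of coefficients belonging to the strictly smaller posets \<open>P - I\<close>, and
  induction on \<open>|P|\<close> applies.
\<close>

section \<open>Cutting order-preserving maps along ideals\<close>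

definition order_ideals :: "'a poset \<Rightarrow> 'a set set" where
  "order_ideals P = {I. order_ideal P I}"

lemma finite_poset_rel_subset: "finite_poset P \<Longrightarrow> snd P \<subseteq> fst P \<times> fst P"
  by (auto simp: finite_poset_def partial_order_on_def preorder_on_def)

lemma fst_induced [simp]: "fst (induced P B) = B"
  by (simp add: induced_def)

lemma finite_poset_induced:
  assumes "finite_poset P" "B \<subseteq> fst P"
  shows "finite_poset (induced P B)"
  using assms finite_subset
  by (fastforce simp: finite_poset_def induced_def partial_order_on_def preorder_on_def
      refl_on_def trans_def antisym_def)

lemma finite_order_ideals: "finite_poset P \<Longrightarrow> finite (order_ideals P)"
  by (rule finite_subset[of _ "Pow (fst P)"])
    (auto simp: order_ideals_def order_ideal_def finite_poset_def)

lemma order_ideals_subset: "I \<in> order_ideals P \<Longrightarrow> I \<subseteq> fst P"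
  by (auto simp: order_ideals_def order_ideal_def)

lemma finite_order_maps: "finite_poset P \<Longrightarrow> finite (order_maps P t)"
  by (rule finite_subset[of _ "fst P \<rightarrow>\<^sub>E {1..t}"])
    (auto simp: order_maps_def finite_poset_def intro!: finite_PiE)

lemma sublevel_order_ideal:
  assumes "finite_poset P" "f \<in> order_maps P t"
  shows "{x \<in> fst P. f x \<le> s} \<in> order_ideals P"
  using finite_poset_rel_subset[OF assms(1)] assms(2)
  by (fastforce simp: order_ideals_def order_ideal_def order_maps_def)

lemma card_order_maps_cut_at_ideal:
  assumes P: "finite_poset P" and I: "I \<in> order_ideals P"
  shows "card {f \<in> order_maps P (s + t). {x \<in> fst P. f x \<le> s} = I}
    = card (order_maps (induced P I) s) * card (order_maps (induced P (fst P - I)) t)"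
proof -
  let ?A = "{f \<in> order_maps P (s + t). {x \<in> fst P. f x \<le> s} = I}"
  let ?L = "order_maps (induced P I) s" and ?U = "order_maps (induced P (fst P - I)) t"
  let ?split = "\<lambda>f. (restrict f I, restrict (\<lambda>x. f x - s) (fst P - I))"
  let ?glue = "\<lambda>(g, h). \<lambda>x\<in>fst P. if x \<in> I then g x else h x + s"
  have sub: "I \<subseteq> fst P" by (rule order_ideals_subset[OF I])
  have down: "x \<in> I" if "(x, y) \<in> snd P" "y \<in> I" for x y
    using I that by (auto simp: order_ideals_def order_ideal_def)
  have rel: "x \<in> fst P \<and> y \<in> fst P" if "(x, y) \<in> snd P" for x y
    using finite_poset_rel_subset[OF P] that by auto
  have "bij_betw ?split ?A (?L \<times> ?U)"
  proof (rule bij_betw_byWitness[where f' = ?glue])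
    show "\<forall>f\<in>?A. ?glue (?split f) = f"
      by (auto simp: order_maps_def PiE_def extensional_def fun_eq_iff)
    show "\<forall>p\<in>?L \<times> ?U. ?split (?glue p) = p"
      using sub
      by (auto simp: order_maps_def induced_def PiE_def extensional_def fun_eq_iff)
    show "?split ` ?A \<subseteq> ?L \<times> ?U"
    proof
      fix p assume "p \<in> ?split ` ?A"
      then obtain f where f: "f \<in> order_maps P (s + t)" and level: "{x \<in> fst P. f x \<le> s} = I"
        and p: "p = ?split f" by auto
      have low: "f x \<le> s \<and> 1 \<le> f x" if "x \<in> I" for x
        using that level f by (auto simp: order_maps_def PiE_def Pi_def)
      have high: "s < f x \<and> f x \<le> s + t" if "x \<in> fst P - I" for x
        using that level f by (auto simp: order_maps_def PiE_def Pi_def)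
      have mono: "f x \<le> f y" if "(x, y) \<in> snd P" for x y
        using f that by (auto simp: order_maps_def)
      have "restrict f I \<in> ?L"
        using low mono by (auto simp: order_maps_def induced_def)
      moreover have "restrict (\<lambda>x. f x - s) (fst P - I) \<in> ?U"
        using high mono by (force simp: order_maps_def induced_def diff_le_mono)
      ultimately show "p \<in> ?L \<times> ?U" by (simp add: p)
    qed
    show "?glue ` (?L \<times> ?U) \<subseteq> ?A"
    proof
      fix f assume "f \<in> ?glue ` (?L \<times> ?U)"
      then obtain g h where g: "g \<in> ?L" and h: "h \<in> ?U" and f: "f = ?glue (g, h)" by auto
      have low: "f x = g x \<and> 1 \<le> g x \<and> g x \<le> s" if "x \<in> I" for x
        using that g sub by (auto simp: f order_maps_def induced_def PiE_def Pi_def)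
      have high: "f x = h x + s \<and> 1 \<le> h x \<and> h x \<le> t" if "x \<in> fst P" "x \<notin> I" for x
        using that h by (auto simp: f order_maps_def induced_def PiE_def Pi_def)
      have "f x \<le> f y" if xy: "(x, y) \<in> snd P" for x y
      proof (cases "x \<in> I \<longleftrightarrow> y \<in> I")
        case True
        then show ?thesis
          using xy rel[OF xy] g h by (auto simp: f order_maps_def induced_def)
      next
        case False
        then show ?thesis
          using down[OF xy] rel[OF xy] low[of x] high[of y] by auto
      qed
      moreover have "f \<in> fst P \<rightarrow>\<^sub>E {1..s + t}"
      proof (rule PiE_I)
        fix x assume "x \<in> fst P"
        then show "f x \<in> {1..s + t}" using low[of x] high[of x] by (cases "x \<in> I") auto
      qed (simp add: f)
      moreover have "{x \<in> fst P. f x \<le> s} = I"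
        using low high sub by fastforce
      ultimately show "f \<in> ?A" by (simp add: order_maps_def)
    qed
  qed
  then show ?thesis
    by (simp add: bij_betw_same_card card_cartesian_product)
qed

lemma card_order_maps_add:
  assumes P: "finite_poset P"
  shows "card (order_maps P (s + t))
    = (\<Sum>I\<in>order_ideals P.
        card (order_maps (induced P I) s) * card (order_maps (induced P (fst P - I)) t))"
proof -
  let ?A = "\<lambda>I. {f \<in> order_maps P (s + t). {x \<in> fst P. f x \<le> s} = I}"
  have "order_maps P (s + t) = (\<Union>I\<in>order_ideals P. ?A I)"
    using sublevel_order_ideal[OF P] by blast
  then have "card (order_maps P (s + t)) = card (\<Union>I\<in>order_ideals P. ?A I)"
    by simp
  also have "\<dots> = (\<Sum>I\<in>order_ideals P. card (?A I))"
    using finite_order_ideals[OF P] finite_order_maps[OF P]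
    by (intro card_UN_disjoint) auto
  finally show ?thesis
    using card_order_maps_cut_at_ideal[OF P] by simp
qed

section \<open>Binomial expansion and polynomiality\<close>

lemma card_order_maps_one:
  assumes "finite_poset P"
  shows "card (order_maps P 1) = 1"
proof -
  have "order_maps P 1 = {\<lambda>x\<in>fst P. 1}"
    using finite_poset_rel_subset[OF assms]
    by (force simp: order_maps_def PiE_def Pi_def extensional_def fun_eq_iff)
  then show ?thesis by simp
qed

lemma order_maps_zero: "fst P \<noteq> {} \<Longrightarrow> order_maps P 0 = {}"
  by (auto simp: order_maps_def PiE_def Pi_def)

lemma card_order_maps_empty:
  assumes "finite_poset P" "fst P = {}"
  shows "card (order_maps P t) = 1"
proof -
  have "order_maps P t = {\<lambda>x. undefined}"
    using assms finite_poset_rel_subset[OF assms(1)] by (auto simp: order_maps_def)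
  then show ?thesis by simp
qed

lemma card_order_maps_Suc:
  assumes P: "finite_poset P"
  shows "card (order_maps P (Suc t)) = card (order_maps P t)
    + (\<Sum>I\<in>order_ideals P - {fst P}. card (order_maps (induced P I) t))"
proof -
  have whole: "fst P \<in> order_ideals P"
    using finite_poset_rel_subset[OF P] by (auto simp: order_ideals_def order_ideal_def)
  have ind: "induced P (fst P) = P"
    using finite_poset_rel_subset[OF P] by (auto simp: induced_def prod_eq_iff)
  have "card (order_maps P (Suc t)) = (\<Sum>I\<in>order_ideals P. card (order_maps (induced P I) t))"
    using card_order_maps_add[OF P, of t 1]
    by (simp add: card_order_maps_one[simplified] finite_poset_induced[OF P])
  then show ?thesis
    using sum.remove[OF finite_order_ideals[OF P] whole, of "\<lambda>I. card (order_maps (induced P I) t)"]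
    by (simp add: ind)
qed

text \<open>Induction on the poset: summing the forward difference raises each \<open>t choose k\<close> to
  \<open>t choose (k+1)\<close>, and the constant of summation is \<open>\<Omega>(P; 0) = 0\<close> for nonempty \<open>P\<close>. The coefficient
  \<open>e k\<close> counts the surjective order-preserving maps onto
  a \<open>k\<close>-chain.\<close>

lemma card_order_maps_binomial_expansion:
  assumes "finite_poset P"
  shows "\<exists>e :: nat \<Rightarrow> nat. \<forall>t. card (order_maps P t) = (\<Sum>k\<le>card (fst P). e k * (t choose k))"
  using assms
proof (induction "card (fst P)" arbitrary: P rule: less_induct)
  case (less P)
  note P = \<open>finite_poset P\<close>
  then have fin: "finite (fst P)" by (simp add: finite_poset_def)
  show ?case
  proof (cases "fst P = {}")
    case True
    then show ?thesis
      using card_order_maps_empty[OF P] by (intro exI[of _ "\<lambda>_. 1"]) simp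
  next
    case False
    then obtain n where n: "card (fst P) = Suc n"
      using fin by (metis card_eq_0_iff not0_implies_Suc)
    let ?J = "order_ideals P - {fst P}"
    have smaller: "card I < card (fst P)" if "I \<in> ?J" for I
      using that order_ideals_subset[of I P] fin by (auto intro!: psubset_card_mono)
    have "\<forall>I\<in>?J. \<exists>e :: nat \<Rightarrow> nat. \<forall>t.
        card (order_maps (induced P I) t) = (\<Sum>k\<le>card I. e k * (t choose k))"
    proof
      fix I assume I: "I \<in> ?J"
      then have "finite_poset (induced P I)"
        using finite_poset_induced[OF P] order_ideals_subset[of I P] by simp
      then show "\<exists>e :: nat \<Rightarrow> nat. \<forall>t.
          card (order_maps (induced P I) t) = (\<Sum>k\<le>card I. e k * (t choose k))"
        using less.hyps[of "induced P I"] smaller[OF I] by simp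
    qed
    then obtain e where e: "card (order_maps (induced P I) t) = (\<Sum>k\<le>card I. e I k * (t choose k))"
      if "I \<in> ?J" for I t
      unfolding bchoice_iff by blast
    define d where "d I k = (if k \<le> card I then e I k else 0 :: nat)" for I k
    \<comment> \<open>Padding with zeros gives all proper ideals the common summation range \<open>{..n}\<close>.\<close>
    have d: "card (order_maps (induced P I) t) = (\<Sum>k\<le>n. d I k * (t choose k))"
      if "I \<in> ?J" for I t
      unfolding e[OF that] d_def using smaller[OF that] n
      by (intro sum.mono_neutral_cong_left) auto
    define c where "c k = (case k of 0 \<Rightarrow> 0 | Suc j \<Rightarrow> (\<Sum>I\<in>?J. d I j))" for k
    have "card (order_maps P t) = (\<Sum>k\<le>Suc n. c k * (t choose k))" for t
    proof (induction t)
      case 0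
      have "(\<Sum>k\<le>Suc n. c k * (0 choose k)) = 0"
        by (rule sum.neutral) (auto simp: c_def split: nat.split)
      then show ?case by (simp add: order_maps_zero[OF False])
    next
      case (Suc t)
      have "(\<Sum>I\<in>?J. card (order_maps (induced P I) t)) = (\<Sum>k\<le>n. c (Suc k) * (t choose k))"
        by (simp add: d c_def sum_distrib_right sum.swap[of _ _ ?J])
      then show ?case
        using Suc unfolding card_order_maps_Suc[OF P] sum.atMost_Suc_shift
        by (simp add: c_def sum.distrib algebra_simps)
    qed
    then show ?thesis unfolding n by blast
  qed
qed

definition binomial_poly :: "nat \<Rightarrow> rat poly" where
  "binomial_poly k = smult (1 / fact k) (\<Prod>i<k. [:- of_nat i, 1:])"

lemma poly_binomial_poly: "poly (binomial_poly k) (of_nat t) = of_nat (t choose k)"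
  by (simp add: binomial_poly_def poly_prod binomial_gbinomial gbinomial_prod_rev
      atLeast0LessThan)

lemma coeff_prod_Ints:
  fixes p :: "'b \<Rightarrow> 'c::comm_ring_1 poly"
  assumes "\<And>i k. i \<in> A \<Longrightarrow> coeff (p i) k \<in> \<int>"
  shows "coeff (\<Prod>i\<in>A. p i) k \<in> \<int>"
  using assms
proof (induction A arbitrary: k rule: infinite_finite_induct)
  case (insert i A)
  then show ?case by (auto simp: coeff_mult intro!: Ints_sum Ints_mult)
qed (auto simp: coeff_1)

lemma fact_mult_coeff_binomial_poly_Ints:
  assumes "k \<le> n"
  shows "fact n * coeff (binomial_poly k) j \<in> \<int>"
proof -
  have "(\<Prod>i<k. [:- of_nat i, 1 :: rat:]) = q \<Longrightarrow> coeff q j \<in> \<int>" for q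
    by (auto intro!: coeff_prod_Ints simp: coeff_pCons split: nat.split)
  moreover obtain m :: nat where m: "fact n = fact k * m"
    using fact_dvd[OF assms] by (metis dvd_def)
  have "(fact n :: rat) = fact k * of_nat m"
    by (metis m of_nat_fact of_nat_mult)
  ultimately show ?thesis
    by (simp add: binomial_poly_def)
qed

lemma poly_eqI_pos_nat:
  fixes p q :: "'c::{idom,ring_char_0} poly"
  assumes "\<And>t::nat. 0 < t \<Longrightarrow> poly p (of_nat t) = poly q (of_nat t)"
  shows "p = q"
proof (rule ccontr)
  assume "p \<noteq> q"
  then have "finite {x. poly (p - q) x = 0}"
    by (intro poly_roots_finite) simp
  moreover have "of_nat ` {0::nat<..} \<subseteq> {x. poly (p - q) x = 0}"
    using assms by auto
  ultimately have "finite (of_nat ` {0::nat<..} :: 'c set)"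
    by (rule finite_subset[rotated])
  then show False
    by (simp add: finite_image_iff inj_on_def infinite_Ioi)
qed

lemma order_polynomial_eqI:
  assumes "\<And>t::nat. 0 < t \<Longrightarrow> poly p (of_nat t) = of_nat (card (order_maps P t))"
  shows "order_polynomial P = p"
  unfolding order_polynomial_def using assms
  by (intro the_equality) (auto intro!: poly_eqI_pos_nat)

lemma order_polynomial_binomial_expansion:
  assumes "finite_poset P"
  obtains e :: "nat \<Rightarrow> nat" where
    "order_polynomial P = (\<Sum>k\<le>card (fst P). smult (of_nat (e k)) (binomial_poly k))"
    "\<And>t. poly (order_polynomial P) (of_nat t) = of_nat (card (order_maps P t))"
proof -
  obtain e :: "nat \<Rightarrow> nat" where
    e: "\<And>t. card (order_maps P t) = (\<Sum>k\<le>card (fst P). e k * (t choose k))"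
    using card_order_maps_binomial_expansion[OF assms] by blast
  let ?p = "\<Sum>k\<le>card (fst P). smult (of_nat (e k)) (binomial_poly k)"
  have p: "poly ?p (of_nat t) = of_nat (card (order_maps P t))" for t
    by (simp add: poly_sum poly_binomial_poly e)
  moreover have "order_polynomial P = ?p"
    using p by (rule order_polynomial_eqI)
  ultimately show thesis using that[of e] by simp
qed

text \<open>The order polynomial is characterised by its values at positive \<open>t\<close>; the binomial expansion
  extends the count to \<open>t = 0\<close>, which makes the constant coefficient a cardinality.\<close>

lemma poly_order_polynomial:
  assumes "finite_poset P"
  shows "poly (order_polynomial P) (of_nat t) = of_nat (card (order_maps P t))"
  using order_polynomial_binomial_expansion[OF assms] by metis

lemma fact_mult_coeff_order_polynomial_Ints:
  assumes "finite_poset P"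
  shows "fact (card (fst P)) * coeff (order_polynomial P) j \<in> \<int>"
proof -
  obtain e :: "nat \<Rightarrow> nat" where e:
    "order_polynomial P = (\<Sum>k\<le>card (fst P). smult (of_nat (e k)) (binomial_poly k))"
    using order_polynomial_binomial_expansion[OF assms] by metis
  have "fact (card (fst P)) * coeff (order_polynomial P) j =
    (\<Sum>k\<le>card (fst P). of_nat (e k) * (fact (card (fst P)) * coeff (binomial_poly k) j))"
    by (simp add: e coeff_sum sum_distrib_left mult.left_commute)
  also have "\<dots> \<in> \<int>"
    by (intro Ints_sum Ints_mult fact_mult_coeff_binomial_poly_Ints) auto
  finally show ?thesis .
qed

section \<open>The derivative of the order polynomial\<close>

text \<open>For a fixed natural \<open>t\<close> both sides of the cutting identity are polynomials in \<open>s\<close>; their linear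
  coefficients are the values at \<open>t\<close> of the two sides below.\<close>

lemma pderiv_order_polynomial:
  assumes P: "finite_poset P"
  shows "pderiv (order_polynomial P)
    = (\<Sum>I\<in>order_ideals P. smult (coeff (order_polynomial (induced P I)) 1)
        (order_polynomial (induced P (fst P - I))))"
    (is "_ = ?R")
proof (rule poly_eqI_pos_nat)
  fix t :: nat
  let ?\<Omega> = "order_polynomial"
  have fin: "finite_poset (induced P I)" "finite_poset (induced P (fst P - I))"
    if "I \<in> order_ideals P" for I
    using finite_poset_induced[OF P] order_ideals_subset[OF that] by auto
  have shift: "pcompose (?\<Omega> P) [:of_nat t, 1:] = (\<Sum>I\<in>order_ideals P.
      smult (poly (?\<Omega> (induced P (fst P - I))) (of_nat t)) (?\<Omega> (induced P I)))"
    (is "?l = ?r")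
  proof (rule poly_eqI_pos_nat)
    fix s :: nat
    have "poly ?l (of_nat s) = poly (?\<Omega> P) (of_nat (s + t))"
      by (simp add: poly_pcompose add.commute)
    also have "\<dots> = poly ?r (of_nat s)"
      unfolding poly_order_polynomial[OF P] card_order_maps_add[OF P]
      by (simp add: poly_sum poly_order_polynomial fin mult.commute)
    finally show "poly ?l (of_nat s) = poly ?r (of_nat s)" .
  qed
  have lin: "coeff p 1 = poly (pderiv p) 0" for p :: "rat poly"
    by (simp add: poly_0_coeff_0 coeff_pderiv)
  have "poly (pderiv (?\<Omega> P)) (of_nat t) = coeff (pcompose (?\<Omega> P) [:of_nat t, 1:]) 1"
    by (simp only: lin pderiv_pcompose) (simp add: poly_pcompose pderiv_pCons)
  also have "\<dots> = poly ?R (of_nat t)"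
    unfolding shift by (simp add: coeff_sum poly_sum mult.commute)
  finally show "poly (pderiv (?\<Omega> P)) (of_nat t) = poly ?R (of_nat t)" .
qed

lemma order_polynomial_empty:
  assumes "finite_poset P" "fst P = {}"
  shows "order_polynomial P = 1"
  by (rule order_polynomial_eqI) (simp add: card_order_maps_empty[OF assms])

lemma coeff_order_polynomial_nonneg:
  fixes \<F> :: "'a poset set"
  assumes fin: "\<And>P. P \<in> \<F> \<Longrightarrow> finite_poset P"
    and closed: "closed_under_ideals \<F>"
    and lin: "\<And>P. P \<in> \<F> \<Longrightarrow> 0 \<le> coeff (order_polynomial P) 1"
    and "P \<in> \<F>"
  shows "0 \<le> coeff (order_polynomial P) k"
  using \<open>P \<in> \<F>\<close>
proof (induction "card (fst P)" arbitrary: P k rule: less_induct)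
  case (less P)
  note P = fin[OF less.prems]
  show ?case
  proof (cases k)
    case 0
    then show ?thesis
      using poly_order_polynomial[OF P, of 0] by (simp add: poly_0_coeff_0)
  next
    case (Suc j)
    have "0 \<le> coeff (order_polynomial (induced P I)) 1
        * coeff (order_polynomial (induced P (fst P - I))) j"
      if I: "I \<in> order_ideals P" for I
    proof (cases "I = {}")
      case True
      then show ?thesis
        by (simp add: order_polynomial_empty finite_poset_induced[OF P])
    next
      case False
      have "card (fst P - I) < card (fst P)"
        using False order_ideals_subset[OF I] P
        by (intro psubset_card_mono) (auto simp: finite_poset_def)
      moreover have "induced P I \<in> \<F>" "induced P (fst P - I) \<in> \<F>"
        using closed less.prems I by (auto simp: closed_under_ideals_def order_ideals_def)
      ultimately show ?thesis
        using lin less.hyps by simp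
    qed
    then have "0 \<le> coeff (pderiv (order_polynomial P)) j"
      unfolding pderiv_order_polynomial[OF P] by (simp add: coeff_sum sum_nonneg)
    then have "0 \<le> (of_nat (Suc j) :: rat) * coeff (order_polynomial P) (Suc j)"
      by (simp only: coeff_pderiv)
    then show ?thesis
      unfolding Suc by (simp add: zero_le_mult_iff del: of_nat_Suc)
  qed
qed

theorem mainTheorem5:
  fixes \<F> :: "'a poset set"
  assumes "\<forall>P\<in>\<F>. finite_poset P"
    and "closed_under_ideals \<F>"
    and "\<forall>P\<in>\<F>. 0 \<le> coeff (order_polynomial P) 1"
  shows "\<forall>P\<in>\<F>. \<forall>k. coeff (smult (fact (card (fst P))) (order_polynomial P)) k \<in> \<int>
           \<and> 0 \<le> coeff (smult (fact (card (fst P))) (order_polynomial P)) k"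
proof (intro ballI allI conjI)
  fix P k assume "P \<in> \<F>"
  then show "coeff (smult (fact (card (fst P))) (order_polynomial P)) k \<in> \<int>"
    using assms(1) by (simp add: fact_mult_coeff_order_polynomial_Ints)
  show "0 \<le> coeff (smult (fact (card (fst P))) (order_polynomial P)) k"
    using assms \<open>P \<in> \<F>\<close> by (simp add: coeff_order_polynomial_nonneg[of \<F>])
qed

end
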